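(* Let $0\le\alpha\le1$ and let $G$ be a connected graph on $n\ge3$ vertices having clique number $\omega\ge2$ and Wiener index $W$. Let $G_1,G_2,\dots,G_k$ be all cliques of $G$ of order $\omega$ and let $s_i=\sum_{v_j\in V(G_i)}Tr(v_j)$. (i) If $\omega\le n-1$, then $$D_\alpha S(G)\ge\max_{1\le i\le k}\frac{\sqrt{\alpha_i^2-4\beta_i\,\omega(n-\omega)}}{\omega(n-\omega)},$$ where $\alpha_i=s_i(\alpha n-2\omega)+\omega\big(2W+(1-\alpha)n(\omega-1)\big)$ and $\beta_i=2W\omega(\omega-1)-s_i^2+2W\alpha\big(s_i-\omega(\omega-1)\big)$. (ii) If $\omega=n$, then $D_\alpha S(G)=(1-\alpha)n$.
   Context: All graphs are finite, undirected and simple. For a connected graph $G$ of order $n$ with vertex set $V(G)$, $d(u,v)$ is the distance between $u$ and $v$, $D(G)=(d(u,v))_{u,v}$ is the distance matrix, $Tr(v)=\sum_{u\in V(G)}d(u,v)$ is the transmission of $v$, $Tr(G)$ is the diagonal matrix of vertex transmissions, and $W=\frac12\sum_v Tr(v)$ is the Wiener index. The clique number $\omega$ is the maximum order of a complete subgraph of $G$. For $0\le\alpha\le1$ the generalized distance matrix is $D_\alpha(G)=\alpha Tr(G)+(1-\alpha)D(G)$, with eigenvalues $\partial_1\ge\partial_2\ge\cdots\ge\partial_n$. The generalized distance spectral spread is $D_\alpha S(G)=\partial_1-\partial_n$. The quantities $\alpha_i$ are distinct from the parameter $\alpha$. *)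

theory Defs
  imports
    "Graph_Theory.Graph_Theory"
    "Jordan_Normal_Form.Char_Poly"
begin

text \<open>
  A finite undirected simple graph is a \<^locale>\<open>graph\<close> of the library: a finite, loop-free,
  symmetric digraph without parallel arcs, an edge being a pair of opposite arcs.
\<close>

text \<open>
  With unit weights the least cost of a walk is the least number of its edges; the value is a
  finite number in a connected graph.
\<close>

definition gdist :: "('a, 'b) pre_digraph \<Rightarrow> 'a \<Rightarrow> 'a \<Rightarrow> real" where
  "gdist G u v = real_of_ereal (wf_digraph.\<mu> G (\<lambda>_. 1) u v)"

definition transmission :: "('a, 'b) pre_digraph \<Rightarrow> 'a \<Rightarrow> real" where
  "transmission G v = (\<Sum>u\<in>verts G. gdist G u v)"

definition wiener_index :: "('a, 'b) pre_digraph \<Rightarrow> real" where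
  "wiener_index G = (1 / 2) * (\<Sum>v\<in>verts G. transmission G v)"

definition cliques :: "('a, 'b) pre_digraph \<Rightarrow> nat \<Rightarrow> ('a, 'b) pre_digraph set" where
  "cliques G m = {H. subgraph H G \<and> complete_digraph m H}"

definition clique_number :: "('a, 'b) pre_digraph \<Rightarrow> nat" where
  "clique_number G = Max {m. cliques G m \<noteq> {}}"

text \<open>
  Library matrices are indexed by natural numbers, so the matrices of a graph depend on an
  enumeration \<open>vs\<close> of its vertices without repetition; their spectra do not depend on it.
\<close>

definition distance_mat :: "('a, 'b) pre_digraph \<Rightarrow> 'a list \<Rightarrow> real mat" where
  "distance_mat G vs = mat (length vs) (length vs) (\<lambda>(i, j). gdist G (vs ! i) (vs ! j))"

definition transmission_mat :: "('a, 'b) pre_digraph \<Rightarrow> 'a list \<Rightarrow> real mat" where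
  "transmission_mat G vs =
     mat (length vs) (length vs) (\<lambda>(i, j). if i = j then transmission G (vs ! i) else 0)"

definition gen_distance_mat :: "real \<Rightarrow> ('a, 'b) pre_digraph \<Rightarrow> 'a list \<Rightarrow> real mat" where
  "gen_distance_mat \<alpha> G vs = \<alpha> \<cdot>\<^sub>m transmission_mat G vs + (1 - \<alpha>) \<cdot>\<^sub>m distance_mat G vs"

text \<open>
  The \<open>i\<close>-th largest eigenvalue (\<open>i = 1, \<dots>, n\<close>), counted with multiplicity. It is meant for real
  symmetric matrices of order \<open>n\<close>, whose characteristic polynomial has \<open>n\<close> real roots.
\<close>

definition nth_eigenvalue :: "real mat \<Rightarrow> nat \<Rightarrow> real" where
  "nth_eigenvalue A i = rev (sorted_list_of_multiset (proots (char_poly A))) ! (i - 1)"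

definition gen_distance_spread :: "real \<Rightarrow> ('a, 'b) pre_digraph \<Rightarrow> 'a list \<Rightarrow> real" where
  "gen_distance_spread \<alpha> G vs =
     nth_eigenvalue (gen_distance_mat \<alpha> G vs) 1 -
     nth_eigenvalue (gen_distance_mat \<alpha> G vs) (length vs)"

end

theory Submission
  imports Defs
begin

text \<open>
  For the test vectors \<open>x = y 1 + z 1\<^sub>S\<close>, \<open>S\<close> being the vertex set of the clique, the forms
  \<open>x \<bullet> x\<close> and \<open>x \<bullet> D\<^sub>\<alpha> x\<close> depend only on \<open>n\<close>, \<open>\<omega>\<close>, \<open>W\<close> and \<open>s\<close>. The extreme eigenvalues bound the
  Rayleigh quotient on all of these vectors, so the binary forms \<open>\<partial>\<^sub>1 x \<bullet> x - x \<bullet> D\<^sub>\<alpha> x\<close> and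
  \<open>x \<bullet> D\<^sub>\<alpha> x - \<partial>\<^sub>n x \<bullet> x\<close> in \<open>(y, z)\<close> are nonnegative; their discriminants put \<open>\<partial>\<^sub>1\<close> and \<open>\<partial>\<^sub>n\<close> on either
  side of the two roots of \<open>\<omega>(n - \<omega>) t\<^sup>2 - a t + b\<close>, whose distance is the claimed bound. For a complete
  graph, \<open>D\<^sub>\<alpha> = (\<alpha> n - 1) I + (1 - \<alpha>) J\<close> has the eigenvalues \<open>n - 1\<close> and \<open>\<alpha> n - 1\<close> only.
\<close>

subsection \<open>Extreme eigenvalues of real symmetric matrices\<close>

lemma scalar_prod_self_pos:
  fixes v :: "real vec"
  assumes "v \<in> carrier_vec n" and "v \<noteq> 0\<^sub>v n"
  shows "v \<bullet> v > 0"
proof -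
  obtain i where i: "i < n" "v $ i \<noteq> 0"
    using assms by (metis carrier_vecD eq_vecI index_zero_vec(1,2))
  have "0 < (\<Sum>j\<in>{0..<n}. v $ j * v $ j)"
    by (rule sum_pos2[of _ i]) (use i in \<open>auto simp: zero_less_mult_iff\<close>)
  thus ?thesis using assms by (simp add: scalar_prod_def)
qed

lemma scalar_prod_self_nonneg: "(v :: real vec) \<bullet> v \<ge> 0"
  by (simp add: scalar_prod_def sum_nonneg)

lemma scalar_prod_mult_mat_vec_sum:
  assumes "A \<in> carrier_mat n n" and "x \<in> carrier_vec n" and "y \<in> carrier_vec n"
  shows "x \<bullet> (A *\<^sub>v y) = (\<Sum>i<n. \<Sum>j<n. x $ i * (A $$ (i, j) * y $ j))"
  using assms by (auto simp: scalar_prod_def sum_distrib_left atLeast0LessThan intro!: sum.cong)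

text \<open>Each product of two coordinates is at most \<open>x \<bullet> x\<close> in absolute
  value, so the sum of the absolute entries serves as a constant; the added 1 makes it
  positive.\<close>

lemma quadratic_form_bounded:
  fixes A :: "real mat"
  assumes A: "A \<in> carrier_mat n n"
  shows "\<exists>K>0. \<forall>x\<in>carrier_vec n. x \<bullet> (A *\<^sub>v x) \<le> K * (x \<bullet> x)"
proof (intro exI conjI ballI)
  let ?K = "(\<Sum>i<n. \<Sum>j<n. \<bar>A $$ (i, j)\<bar>) + 1"
  show "?K > 0" by (intro add_nonneg_pos sum_nonneg) auto
  fix x :: "real vec" assume x: "x \<in> carrier_vec n"
  have sq: "(x $ i)\<^sup>2 \<le> x \<bullet> x" if "i < n" for i
  proof -
    have "(x $ i)\<^sup>2 \<le> (\<Sum>j\<in>{0..<n}. (x $ j)\<^sup>2)"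
      by (rule member_le_sum) (use that in auto)
    thus ?thesis using x by (simp add: scalar_prod_def power2_eq_square)
  qed
  have "x \<bullet> (A *\<^sub>v x) \<le> (\<Sum>i<n. \<Sum>j<n. \<bar>A $$ (i, j)\<bar> * (x \<bullet> x))"
    unfolding scalar_prod_mult_mat_vec_sum[OF A x x]
  proof (intro sum_mono)
    fix i j assume ij: "i \<in> {..<n}" "j \<in> {..<n}"
    have "2 * (\<bar>x $ i\<bar> * \<bar>x $ j\<bar>) \<le> (x $ i)\<^sup>2 + (x $ j)\<^sup>2"
      using sum_squares_bound[of "\<bar>x $ i\<bar>" "\<bar>x $ j\<bar>"] by simp
    hence le: "\<bar>x $ i\<bar> * \<bar>x $ j\<bar> \<le> x \<bullet> x"
      using sq[of i] sq[of j] ij by simp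
    have "x $ i * (A $$ (i, j) * x $ j) \<le> \<bar>x $ i * (A $$ (i, j) * x $ j)\<bar>" by simp
    also have "\<dots> = \<bar>A $$ (i, j)\<bar> * (\<bar>x $ i\<bar> * \<bar>x $ j\<bar>)" by (simp add: abs_mult)
    also have "\<dots> \<le> \<bar>A $$ (i, j)\<bar> * (x \<bullet> x)" using le by (intro mult_left_mono) auto
    finally show "x $ i * (A $$ (i, j) * x $ j) \<le> \<bar>A $$ (i, j)\<bar> * (x \<bullet> x)" .
  qed
  also have "\<dots> = (\<Sum>i<n. \<Sum>j<n. \<bar>A $$ (i, j)\<bar>) * (x \<bullet> x)"
    by (simp add: sum_distrib_right)
  also have "\<dots> \<le> ?K * (x \<bullet> x)"
    using scalar_prod_self_nonneg[of x] by (simp add: algebra_simps)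
  finally show "x \<bullet> (A *\<^sub>v x) \<le> ?K * (x \<bullet> x)" .
qed

text \<open>Serves twice: for Cauchy-Schwarz, and to turn Rayleigh bounds on a plane of test vectors
  into quadratic inequalities for the extreme eigenvalues.\<close>

lemma binary_form_nonneg_imp_discriminant:
  fixes a b c :: real
  assumes nonneg: "\<And>y z. 0 \<le> a * y\<^sup>2 + 2 * b * y * z + c * z\<^sup>2"
  shows "b\<^sup>2 \<le> a * c"
proof (cases "a = 0")
  case True
  show ?thesis
  proof (cases "b = 0")
    case False
    \<comment> \<open>With \<open>a = 0\<close> the form at \<open>z = 1\<close> is affine in
      \<open>y\<close>; this \<open>y\<close> is where it takes the value -1.\<close>
    have "0 \<le> a * (-(c + 1) / (2 * b))\<^sup>2 + 2 * b * (-(c + 1) / (2 * b)) * 1 + c * 1\<^sup>2"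
      by (rule nonneg)
    with True False show ?thesis by simp
  qed (use True in simp)
next
  case False
  have "0 \<le> a" using nonneg[of 1 0] by simp
  \<comment> \<open>At \<open>y = - b\<close>, \<open>z = a\<close> the form equals \<open>a\<close>
    times the quantity to be signed.\<close>
  moreover have "0 \<le> a * (a * c - b\<^sup>2)"
    using nonneg[of "- b" a] by (simp add: algebra_simps power2_eq_square)
  ultimately show ?thesis using False by (simp add: zero_le_mult_iff)
qed

lemma symmetric_mat_commute:
  fixes A :: "real mat"
  assumes A: "A \<in> carrier_mat n n" and sym: "transpose_mat A = A"
    and "x \<in> carrier_vec n" and "y \<in> carrier_vec n"
  shows "x \<bullet> (A *\<^sub>v y) = y \<bullet> (A *\<^sub>v x)"
proof -
  have "x \<bullet> (A *\<^sub>v y) = (A *\<^sub>v x) \<bullet> y"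
    using transpose_vec_mult_scalar[OF A assms(4,3)] sym by simp
  also have "\<dots> = y \<bullet> (A *\<^sub>v x)"
    using A assms(3,4) by (intro comm_scalar_prod[of _ n]) auto
  finally show ?thesis .
qed

text \<open>Restricted to the combinations \<open>s x + t y\<close>, the form is a nonnegative
  binary form in \<open>(s, t)\<close>; the claim is its discriminant inequality.\<close>

lemma nonneg_form_Cauchy_Schwarz:
  fixes A :: "real mat"
  assumes A: "A \<in> carrier_mat n n" and sym: "transpose_mat A = A"
    and nonneg: "\<And>x. x \<in> carrier_vec n \<Longrightarrow> 0 \<le> x \<bullet> (A *\<^sub>v x)"
    and x: "x \<in> carrier_vec n" and y: "y \<in> carrier_vec n"
  shows "(x \<bullet> (A *\<^sub>v y))\<^sup>2 \<le> (x \<bullet> (A *\<^sub>v x)) * (y \<bullet> (A *\<^sub>v y))"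
proof (rule binary_form_nonneg_imp_discriminant)
  fix s t :: real
  have [simp]: "A *\<^sub>v x \<in> carrier_vec n" "A *\<^sub>v y \<in> carrier_vec n" using A x y by auto
  have "A *\<^sub>v (s \<cdot>\<^sub>v x + t \<cdot>\<^sub>v y) = s \<cdot>\<^sub>v (A *\<^sub>v x) + t \<cdot>\<^sub>v (A *\<^sub>v y)"
    using A x y by (simp add: mult_add_distrib_mat_vec[of _ n n] mult_mat_vec[of _ n n])
  hence "(s \<cdot>\<^sub>v x + t \<cdot>\<^sub>v y) \<bullet> (A *\<^sub>v (s \<cdot>\<^sub>v x + t \<cdot>\<^sub>v y)) =
      (x \<bullet> (A *\<^sub>v x)) * s\<^sup>2 + 2 * (x \<bullet> (A *\<^sub>v y)) * s * t + (y \<bullet> (A *\<^sub>v y)) * t\<^sup>2"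
    using x y symmetric_mat_commute[OF A sym y x]
    by (simp add: add_scalar_prod_distrib[of _ n] scalar_prod_add_distrib[of _ n]
        smult_scalar_prod_distrib[of _ n] scalar_prod_smult_distrib[of _ n]
        algebra_simps power2_eq_square)
  moreover have "0 \<le> (s \<cdot>\<^sub>v x + t \<cdot>\<^sub>v y) \<bullet> (A *\<^sub>v (s \<cdot>\<^sub>v x + t \<cdot>\<^sub>v y))"
    using x y by (intro nonneg) auto
  ultimately show "0 \<le> (x \<bullet> (A *\<^sub>v x)) * s\<^sup>2 + 2 * (x \<bullet> (A *\<^sub>v y)) * s * t + (y \<bullet> (A *\<^sub>v y)) * t\<^sup>2"
    by simp
qed

text \<open>Cauchy-Schwarz for \<open>x\<close> and \<open>y = B x\<close>, with \<open>B\<close>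
  the inverse of \<open>A\<close>, bounds the square of \<open>x \<bullet> x\<close> by
  \<open>(x \<bullet> A x) (x \<bullet> B x)\<close>. The last factor is at most
  \<open>K (x \<bullet> x)\<close>, and one factor \<open>x \<bullet> x\<close> cancels.\<close>

lemma nonneg_nonsingular_form_bounded_below:
  fixes A :: "real mat"
  assumes A: "A \<in> carrier_mat n n" and sym: "transpose_mat A = A"
    and nonneg: "\<And>x. x \<in> carrier_vec n \<Longrightarrow> 0 \<le> x \<bullet> (A *\<^sub>v x)"
    and det: "det A \<noteq> 0"
  shows "\<exists>K>0. \<forall>x\<in>carrier_vec n. x \<bullet> x \<le> K * (x \<bullet> (A *\<^sub>v x))"
proof -
  obtain B where B: "B \<in> carrier_mat n n" and AB: "A * B = 1\<^sub>m n"
    using det_non_zero_imp_unit[OF A det, of "()"] unfolding Units_def ring_mat_def by auto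
  obtain K where K: "K > 0" "\<And>x. x \<in> carrier_vec n \<Longrightarrow> x \<bullet> (B *\<^sub>v x) \<le> K * (x \<bullet> x)"
    using quadratic_form_bounded[OF B] by auto
  have "x \<bullet> x \<le> K * (x \<bullet> (A *\<^sub>v x))" if x: "x \<in> carrier_vec n" for x
  proof (cases "x = 0\<^sub>v n")
    case True
    thus ?thesis using A by simp
  next
    case False
    let ?y = "B *\<^sub>v x"
    have y: "?y \<in> carrier_vec n" using B x by simp
    have Ay: "A *\<^sub>v ?y = x"
      using assoc_mult_mat_vec[OF A B x] AB x by simp
    have "(x \<bullet> x)\<^sup>2 \<le> (x \<bullet> (A *\<^sub>v x)) * (?y \<bullet> x)"
      using nonneg_form_Cauchy_Schwarz[OF A sym nonneg x y] Ay by simp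
    also have "?y \<bullet> x = x \<bullet> ?y" using comm_scalar_prod[OF y x] .
    also have "(x \<bullet> (A *\<^sub>v x)) * (x \<bullet> ?y) \<le> (x \<bullet> (A *\<^sub>v x)) * (K * (x \<bullet> x))"
      by (intro mult_left_mono K nonneg x)
    finally have "(x \<bullet> x) * (x \<bullet> x) \<le> (K * (x \<bullet> (A *\<^sub>v x))) * (x \<bullet> x)"
      by (simp add: power2_eq_square algebra_simps)
    thus ?thesis using scalar_prod_self_pos[OF x False] by (simp add: mult_le_cancel_right)
  qed
  with K(1) show ?thesis by blast
qed

text \<open>
  The least upper bound \<open>M\<close> of the Rayleigh quotient is an eigenvalue: otherwise \<open>M I - A\<close> would be
  nonnegative and nonsingular, hence bounded below, and \<open>M\<close> could be lowered. This avoids both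
  compactness of the sphere and diagonalization.
\<close>

lemma symmetric_mat_eigenvalue_upper_bound:
  fixes A :: "real mat"
  assumes A: "A \<in> carrier_mat n n" and sym: "transpose_mat A = A" and n: "n > 0"
  shows "\<exists>M. eigenvalue A M \<and> (\<forall>x\<in>carrier_vec n. x \<bullet> (A *\<^sub>v x) \<le> M * (x \<bullet> x))"
proof -
  define T where "T = {t. \<forall>x\<in>carrier_vec n. x \<bullet> (A *\<^sub>v x) \<le> t * (x \<bullet> x)}"
  define M where "M = Inf T"
  have ratio: "(x \<bullet> (A *\<^sub>v x)) / (x \<bullet> x) \<le> t"
    if "t \<in> T" "x \<in> carrier_vec n" "x \<noteq> 0\<^sub>v n" for t x
    using that scalar_prod_self_pos[of x n] by (auto simp: T_def field_simps)
  obtain K where "K \<in> T" using quadratic_form_bounded[OF A] by (auto simp: T_def)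
  hence ne: "T \<noteq> {}" by auto
  have "unit_vec n 0 \<in> carrier_vec n" "unit_vec n 0 \<noteq> (0\<^sub>v n :: real vec)"
    using n by (auto simp: unit_vec_def vec_eq_iff)
  \<comment> \<open>The Rayleigh quotient of any nonzero vector is a lower bound of
    \<open>T\<close>; the unit vector is one, as \<open>n > 0\<close>.\<close>
  hence bdd: "bdd_below T" unfolding bdd_below_def using ratio by blast
  have MT: "x \<bullet> (A *\<^sub>v x) \<le> M * (x \<bullet> x)" if x: "x \<in> carrier_vec n" for x
  proof (cases "x = 0\<^sub>v n")
    case True
    thus ?thesis using A by simp
  next
    case False
    have "(x \<bullet> (A *\<^sub>v x)) / (x \<bullet> x) \<le> M"
      unfolding M_def by (rule cInf_greatest[OF ne]) (rule ratio[OF _ x False])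
    thus ?thesis using scalar_prod_self_pos[OF x False] by (simp add: field_simps)
  qed
  \<comment> \<open>\<open>C\<close> is \<open>A - M I\<close>, so \<open>- C\<close> is the matrix
    with nonnegative form.\<close>
  define C where "C = char_matrix A M"
  have C: "C \<in> carrier_mat n n" using A by (simp add: C_def)
  have Cx: "x \<bullet> (- C *\<^sub>v x) = M * (x \<bullet> x) - x \<bullet> (A *\<^sub>v x)" if x: "x \<in> carrier_vec n" for x
  proof -
    have "((- M) \<cdot>\<^sub>m 1\<^sub>m n) *\<^sub>v x = (- M) \<cdot>\<^sub>v x"
      using x by (intro eq_vecI) auto
    hence "C *\<^sub>v x = A *\<^sub>v x + (- M) \<cdot>\<^sub>v x"
      using A x by (simp add: C_def char_matrix_def add_mult_distrib_mat_vec[of _ n n])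
    moreover have "A *\<^sub>v x \<in> carrier_vec n" using A x by simp
    ultimately show ?thesis using C A x
      by (simp add: scalar_prod_add_distrib[of _ n])
  qed
  have symC: "transpose_mat (- C) = - C"
  proof -
    have "A $$ (i, j) = A $$ (j, i)" if "i < n" "j < n" for i j
      using sym A that by (metis index_transpose_mat(1) carrier_matD)
    thus ?thesis using A by (intro eq_matI) (auto simp: C_def char_matrix_def)
  qed
  have "det C = 0"
  proof (rule ccontr)
    assume "det C \<noteq> 0"
    moreover have "- C = (- 1) \<cdot>\<^sub>m C" by (intro eq_matI) auto
    ultimately have "det (- C) \<noteq> 0" by (simp add: det_smult)
    then obtain K where K: "K > 0"
      "\<And>x. x \<in> carrier_vec n \<Longrightarrow> x \<bullet> x \<le> K * (x \<bullet> (- C *\<^sub>v x))"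
      using nonneg_nonsingular_form_bounded_below[of "- C" n] C symC Cx MT by fastforce
    \<comment> \<open>Dividing by \<open>K\<close> gives
      \<open>x \<bullet> A x \<le> (M - 1 / K) (x \<bullet> x)\<close>, against the choice of
      \<open>M\<close> as infimum.\<close>
    have "M - 1 / K \<in> T"
      unfolding T_def using K(1) K(2) Cx by (auto simp: field_simps)
    hence "M \<le> M - 1 / K" unfolding M_def by (rule cInf_lower[OF _ bdd])
    with K(1) show False by simp
  qed
  hence "eigenvalue A M" using eigenvalue_det[OF A] by (simp add: C_def)
  with MT show ?thesis by blast
qed

text \<open>The upper bound for \<open>- A\<close>, with all signs reversed.\<close>

lemma symmetric_mat_eigenvalue_lower_bound:
  fixes A :: "real mat"
  assumes A: "A \<in> carrier_mat n n" and sym: "transpose_mat A = A" and n: "n > 0"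
  shows "\<exists>m. eigenvalue A m \<and> (\<forall>x\<in>carrier_vec n. m * (x \<bullet> x) \<le> x \<bullet> (A *\<^sub>v x))"
proof -
  have "transpose_mat (- A) = - A"
    using sym by (metis transpose_uminus)
  then obtain M where M: "eigenvalue (- A) M"
    "\<And>x. x \<in> carrier_vec n \<Longrightarrow> x \<bullet> (- A *\<^sub>v x) \<le> M * (x \<bullet> x)"
    using symmetric_mat_eigenvalue_upper_bound[of "- A" n] A n by auto
  from M(1) obtain v where v: "v \<in> carrier_vec n" "v \<noteq> 0\<^sub>v n" "- A *\<^sub>v v = M \<cdot>\<^sub>v v"
    using A by (auto simp: eigenvalue_def eigenvector_def)
  have "A *\<^sub>v v = (- M) \<cdot>\<^sub>v v"
  proof -
    have "- (A *\<^sub>v v) = M \<cdot>\<^sub>v v" using v A by simp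
    hence "A *\<^sub>v v = - (M \<cdot>\<^sub>v v)" by (metis uminus_uminus_vec)
    thus ?thesis by auto
  qed
  hence "eigenvalue A (- M)"
    using v A by (auto simp: eigenvalue_def eigenvector_def)
  moreover have "(- M) * (x \<bullet> x) \<le> x \<bullet> (A *\<^sub>v x)" if "x \<in> carrier_vec n" for x
    using M(2)[OF that] that A by simp
  ultimately show ?thesis by blast
qed

section \<open>Real spectrum and the sorted list of eigenvalues\<close>

text \<open>For an eigenvector \<open>x + i y\<close>, the real and imaginary parts of the
  eigenvalue equation express \<open>A x\<close> and \<open>A y\<close> through \<open>x\<close> and
  \<open>y\<close>. Comparing \<open>x \<bullet> A y\<close> with \<open>y \<bullet> A x\<close>
  leaves \<open>Im e (x \<bullet> x + y \<bullet> y) = 0\<close>.\<close>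

lemma symmetric_mat_complex_eigenvalue_real:
  fixes A :: "real mat"
  assumes A: "A \<in> carrier_mat n n" and sym: "transpose_mat A = A"
    and ev: "eigenvalue (map_mat complex_of_real A) e"
  shows "Im e = 0"
proof -
  obtain v where v: "v \<in> carrier_vec n" "v \<noteq> 0\<^sub>v n"
    and Av: "map_mat complex_of_real A *\<^sub>v v = e \<cdot>\<^sub>v v"
    using ev A by (auto simp: eigenvalue_def eigenvector_def)
  define x y where "x = map_vec Re v" and "y = map_vec Im v"
  have xy: "x \<in> carrier_vec n" "y \<in> carrier_vec n" using v by (auto simp: x_def y_def)
  have row: "(\<Sum>j\<in>{0..<n}. complex_of_real (A $$ (i, j)) * v $ j) = e * v $ i" if "i < n" for i
    using arg_cong[OF Av, of "\<lambda>w. w $ i"] that A v by (simp add: scalar_prod_def)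
  have Ax: "A *\<^sub>v x = Re e \<cdot>\<^sub>v x + (- Im e) \<cdot>\<^sub>v y"
  proof (rule eq_vecI)
    fix i assume "i < dim_vec (Re e \<cdot>\<^sub>v x + (- Im e) \<cdot>\<^sub>v y)"
    hence i: "i < n" using xy by simp
    show "(A *\<^sub>v x) $ i = (Re e \<cdot>\<^sub>v x + (- Im e) \<cdot>\<^sub>v y) $ i"
      using arg_cong[OF row[OF i], of Re] i A v by (simp add: scalar_prod_def x_def y_def)
  qed (use A xy in auto)
  have Ay: "A *\<^sub>v y = Re e \<cdot>\<^sub>v y + Im e \<cdot>\<^sub>v x"
  proof (rule eq_vecI)
    fix i assume "i < dim_vec (Re e \<cdot>\<^sub>v y + Im e \<cdot>\<^sub>v x)"
    hence i: "i < n" using xy by simp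
    show "(A *\<^sub>v y) $ i = (Re e \<cdot>\<^sub>v y + Im e \<cdot>\<^sub>v x) $ i"
      using arg_cong[OF row[OF i], of Im] i A v by (simp add: scalar_prod_def x_def y_def)
  qed (use A xy in auto)
  have "x \<bullet> (A *\<^sub>v y) = y \<bullet> (A *\<^sub>v x)"
    by (rule symmetric_mat_commute[OF A sym xy])
  hence "Im e * (x \<bullet> x + y \<bullet> y) = 0"
    using xy comm_scalar_prod[OF xy]
    by (simp add: Ax Ay scalar_prod_add_distrib[of _ n] algebra_simps)
  moreover have "x \<noteq> 0\<^sub>v n \<or> y \<noteq> 0\<^sub>v n"
  proof (rule ccontr)
    assume "\<not> ?thesis"
    hence "x $ i = 0" "y $ i = 0" if "i < n" for i using that by auto
    hence "v = 0\<^sub>v n" using v(1) by (intro eq_vecI) (auto simp: x_def y_def complex_eq_iff)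
    with v(2) show False ..
  qed
  hence "x \<bullet> x + y \<bullet> y > 0"
    using scalar_prod_self_pos xy scalar_prod_self_nonneg[of x] scalar_prod_self_nonneg[of y]
    by (meson add_pos_nonneg add_nonneg_pos)
  ultimately show ?thesis by simp
qed

text \<open>The characteristic polynomial splits over the complex numbers with real roots only, and
  the factorization descends to the reals since the embedding is injective. Hence the list behind
  \<open>nth_eigenvalue\<close> has full length and the index \<open>n\<close> is valid.\<close>

lemma symmetric_mat_size_proots_char_poly:
  fixes A :: "real mat"
  assumes A: "A \<in> carrier_mat n n" and sym: "transpose_mat A = A"
  shows "size (proots (char_poly A)) = n"
proof -
  let ?A = "map_mat complex_of_real A"
  have A': "?A \<in> carrier_mat n n" using A by simp
  obtain as where as: "char_poly ?A = (\<Prod>a\<leftarrow>as. [:- a, 1:])" "length as = n"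
    using char_poly_factorized[OF A'] by blast
  have real: "complex_of_real (Re a) = a" if "a \<in> set as" for a
  proof -
    have "poly (char_poly ?A) a = 0"
      unfolding as(1) poly_prod_list using that by (force simp: prod_list_zero_iff)
    hence "Im a = 0"
      using symmetric_mat_complex_eigenvalue_real[OF A sym] eigenvalue_root_char_poly[OF A'] by blast
    thus ?thesis by (simp add: complex_eq_iff)
  qed
  interpret of_real_poly_hom: map_poly_inj_comm_ring_hom complex_of_real ..
  have "map_poly complex_of_real (char_poly A) = (\<Prod>a\<leftarrow>as. [:- a, 1:])"
    using of_real_hom.char_poly_hom[OF A] as(1) by metis
  also have "\<dots> = (\<Prod>a\<leftarrow>as. map_poly complex_of_real [:- Re a, 1:])"
    using real by (intro arg_cong[of _ _ prod_list] map_cong) auto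
  also have "\<dots> = map_poly complex_of_real (\<Prod>a\<leftarrow>as. [:- Re a, 1:])"
    by (simp add: of_real_poly_hom.hom_prod_list o_def)
  finally have eq: "char_poly A = (\<Prod>a\<leftarrow>as. [:- Re a, 1:])"
    using of_real_poly_hom.injectivity by blast
  have "proots (char_poly A) = (\<Sum>p\<leftarrow>map (\<lambda>a. [:- Re a, 1:]) as. proots p)"
    unfolding eq using proots_prod_list[of "map (\<lambda>a. [:- Re a, 1:]) as"] by (auto simp: o_def image_iff)
  also have "\<dots> = mset (map Re as)" by (induction as) auto
  finally show ?thesis using as(2) by simp
qed

lemma set_proots_char_poly:
  fixes A :: "real mat"
  assumes A: "A \<in> carrier_mat n n"
  shows "set_mset (proots (char_poly A)) = {e. eigenvalue A e}"
proof -
  have "char_poly A \<noteq> 0" using degree_monic_char_poly[OF A] by auto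
  thus ?thesis using eigenvalue_root_char_poly[OF A] by auto
qed

lemma symmetric_mat_extreme_nth_eigenvalue:
  fixes A :: "real mat"
  assumes A: "A \<in> carrier_mat n n" and sym: "transpose_mat A = A" and n: "n > 0"
  shows "nth_eigenvalue A 1 = Max {e. eigenvalue A e}"
    and "nth_eigenvalue A n = Min {e. eigenvalue A e}"
    and "finite {e. eigenvalue A e}"
    and "{e. eigenvalue A e} \<noteq> {}"
proof -
  define l where "l = sorted_list_of_multiset (proots (char_poly A))"
  have len: "length l = n"
    using symmetric_mat_size_proots_char_poly[OF A sym]
    by (metis l_def mset_sorted_list_of_multiset size_mset)
  have set: "set l = {e. eigenvalue A e}"
    using set_proots_char_poly[OF A] by (simp add: l_def)
  have sorted: "sorted l" by (simp add: l_def)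
  show fin: "finite {e. eigenvalue A e}" by (metis set finite_set)
  show "{e. eigenvalue A e} \<noteq> {}" using set len n by (metis length_0_conv less_irrefl set_empty)
  \<comment> \<open>The list \<open>l\<close> is ascending and gets reversed: position 1 reads its
    last entry, position \<open>n\<close> its first.\<close>
  have "nth_eigenvalue A 1 = l ! (n - 1)" "nth_eigenvalue A n = l ! 0"
    using len n by (auto simp: nth_eigenvalue_def l_def[symmetric] rev_nth)
  moreover have "Max {e. eigenvalue A e} = l ! (n - 1)"
  proof (rule Max_eqI[OF fin])
    fix e assume "e \<in> {e. eigenvalue A e}"
    then obtain k where "k < n" "e = l ! k" by (metis set len in_set_conv_nth)
    thus "e \<le> l ! (n - 1)" using sorted_nth_mono[OF sorted, of k "n - 1"] len by auto
  next
    show "l ! (n - 1) \<in> {e. eigenvalue A e}" using set len n nth_mem[of "n - 1" l] by auto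
  qed
  moreover have "Min {e. eigenvalue A e} = l ! 0"
  proof (rule Min_eqI[OF fin])
    fix e assume "e \<in> {e. eigenvalue A e}"
    then obtain k where "k < n" "e = l ! k" by (metis set len in_set_conv_nth)
    thus "l ! 0 \<le> e" using sorted_nth_mono[OF sorted, of 0 k] len by auto
  next
    show "l ! 0 \<in> {e. eigenvalue A e}" using set len n by (metis nth_mem)
  qed
  ultimately show "nth_eigenvalue A 1 = Max {e. eigenvalue A e}"
    and "nth_eigenvalue A n = Min {e. eigenvalue A e}" by simp_all
qed

text \<open>Some eigenvalues bound the quotient from above and from below. The greatest and least
  eigenvalues can replace them because \<open>x \<bullet> x\<close> is nonnegative.\<close>

lemma symmetric_mat_nth_eigenvalue_Rayleigh:
  fixes A :: "real mat"
  assumes A: "A \<in> carrier_mat n n" and sym: "transpose_mat A = A" and n: "n > 0"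
    and x: "x \<in> carrier_vec n"
  shows "x \<bullet> (A *\<^sub>v x) \<le> nth_eigenvalue A 1 * (x \<bullet> x)"
    and "nth_eigenvalue A n * (x \<bullet> x) \<le> x \<bullet> (A *\<^sub>v x)"
proof -
  note extreme = symmetric_mat_extreme_nth_eigenvalue[OF A sym n]
  obtain M m where M: "eigenvalue A M" "x \<bullet> (A *\<^sub>v x) \<le> M * (x \<bullet> x)"
    and m: "eigenvalue A m" "m * (x \<bullet> x) \<le> x \<bullet> (A *\<^sub>v x)"
    using symmetric_mat_eigenvalue_upper_bound[OF A sym n]
      symmetric_mat_eigenvalue_lower_bound[OF A sym n] x by blast
  have "M \<le> nth_eigenvalue A 1" "nth_eigenvalue A n \<le> m"
    using extreme M(1) m(1) by auto
  thus "x \<bullet> (A *\<^sub>v x) \<le> nth_eigenvalue A 1 * (x \<bullet> x)"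
    and "nth_eigenvalue A n * (x \<bullet> x) \<le> x \<bullet> (A *\<^sub>v x)"
    using M(2) m(2) scalar_prod_self_nonneg[of x] by (meson mult_right_mono order_trans)+
qed

subsection \<open>Distances and cliques\<close>

text \<open>Every arc has an opposite arc; replacing each arc by its opposite and reversing the
  order keeps the length. This yields the symmetry of the distance.\<close>

lemma (in sym_digraph) awalk_reverse:
  assumes "awalk u p v"
  shows "\<exists>q. awalk v q u \<and> length q = length p"
  using assms
proof (induction p arbitrary: u)
  case Nil
  thus ?case by (auto simp: awalk_Nil_iff)
next
  case (Cons e p)
  hence e: "e \<in> arcs G" "u = tail G e" and p: "awalk (head G e) p v"
    by (auto simp: awalk_Cons_iff)
  obtain q where q: "awalk v q (head G e)" "length q = length p" using Cons.IH[OF p] by blast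
  obtain e' where e': "e' \<in> arcs G" "tail G e' = head G e" "head G e' = tail G e"
    using sym_arcs e(1) unfolding symmetric_conv by metis
  have "awalk (head G e) [e'] u" using arc_implies_awalk[OF e'(1)] e' e(2) by simp
  hence "awalk v (q @ [e']) u" using q(1) by (rule awalk_appendI[rotated])
  with q(2) show ?case by (intro exI[of _ "q @ [e']"]) simp
qed

lemma (in wf_digraph) awalk_cost_unit: "awalk_cost (\<lambda>_. 1) p = real (length p)"
  by (induction p) auto

lemma (in sym_digraph) unit_distance_le_commute:
  "\<mu> (\<lambda>_. 1) u v \<le> \<mu> (\<lambda>_. 1) v u"
  unfolding \<mu>_def
proof (rule INF_mono)
  fix p assume "p \<in> {p. awalk v p u}"
  then obtain q where "awalk u q v" "length q = length p" using awalk_reverse by blast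
  thus "\<exists>q\<in>{q. awalk u q v}. ereal (awalk_cost (\<lambda>_. 1) q) \<le> ereal (awalk_cost (\<lambda>_. 1) p)"
    by (auto simp: awalk_cost_unit)
qed

lemma (in sym_digraph) gdist_commute: "gdist G u v = gdist G v u"
  unfolding gdist_def by (metis unit_distance_le_commute order_antisym)

lemma (in wf_digraph) gdist_self:
  assumes "v \<in> verts G"
  shows "gdist G v v = 0"
proof -
  have "\<mu> (\<lambda>_. 1) v v = 0" unfolding \<mu>_def
  proof (rule antisym)
    show "(INF p\<in>{p. awalk v p v}. ereal (awalk_cost (\<lambda>_. 1) p)) \<le> 0"
      by (rule INF_lower2[of "[]"]) (use assms in \<open>auto simp: awalk_Nil_iff\<close>)
  qed (auto intro!: INF_greatest simp: awalk_cost_unit)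
  thus ?thesis by (simp add: gdist_def)
qed

text \<open>One arc is a walk of cost 1, and a walk between distinct vertices has at least one
  arc.\<close>

lemma (in wf_digraph) gdist_adjacent:
  assumes "u \<rightarrow>\<^bsub>G\<^esub> v" and "u \<noteq> v"
  shows "gdist G u v = 1"
proof -
  obtain e where e: "awalk u [e] v"
    using assms(1) arc_implies_awalk by (auto simp: arcs_ends_conv)
  have "\<mu> (\<lambda>_. 1) u v = 1" unfolding \<mu>_def
  proof (rule antisym)
    show "(INF p\<in>{p. awalk u p v}. ereal (awalk_cost (\<lambda>_. 1) p)) \<le> 1"
      by (rule INF_lower2[of "[e]"]) (use e in auto)
    show "1 \<le> (INF p\<in>{p. awalk u p v}. ereal (awalk_cost (\<lambda>_. 1) p))"
    proof (rule INF_greatest)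
      fix p assume "p \<in> {p. awalk u p v}"
      hence "p \<noteq> []" using assms(2) by (auto simp: awalk_Nil_iff)
      hence "length p \<ge> 1" by (cases p) auto
      thus "1 \<le> ereal (awalk_cost (\<lambda>_. 1) p)" by (simp add: awalk_cost_unit)
    qed
  qed
  thus ?thesis by (simp add: gdist_def)
qed

text \<open>Arcs of \<open>H\<close> are arcs of \<open>G\<close>, so distinct vertices of the
  clique are adjacent in \<open>G\<close>, where the distance is measured.\<close>

lemma gdist_clique:
  assumes "H \<in> cliques G m" and "u \<in> verts H" and "v \<in> verts H"
  shows "gdist G u v = (if u = v then 0 else 1)"
proof -
  have H: "subgraph H G" "complete_digraph m H" using assms(1) by (auto simp: cliques_def)
  interpret wf_digraph G using H(1) by (simp add: subgraph_def)
  show ?thesis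
  proof (cases "u = v")
    case True
    thus ?thesis using gdist_self H(1) assms(2) by (auto simp: subgraph_def)
  next
    case False
    hence "(u, v) \<in> arcs_ends H" using H(2) assms by (auto simp: complete_digraph_def)
    hence "(u, v) \<in> arcs_ends G"
      using H(1) by (auto simp: arcs_ends_conv subgraph_def compatible_def)
    thus ?thesis using gdist_adjacent False by simp
  qed
qed

lemma sum_gdist_clique:
  assumes "H \<in> cliques G m"
  shows "(\<Sum>u\<in>verts H. \<Sum>v\<in>verts H. gdist G u v) = real m * (real m - 1)"
proof -
  have H: "card (verts H) = m" "finite (verts H)"
    using assms by (auto simp: cliques_def complete_digraph_def graph_def digraph_def fin_digraph_def
        fin_digraph_axioms_def)
  have "(\<Sum>v\<in>verts H. gdist G u v) = real m - 1" if u: "u \<in> verts H" for u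
  proof -
    have "(\<Sum>v\<in>verts H. gdist G u v) = (\<Sum>v\<in>verts H. 1 - of_bool (u = v))"
      by (rule sum.cong) (use gdist_clique[OF assms u] in auto)
    also have "\<dots> = real m - 1"
      using H u by (simp add: sum_subtractf of_bool_def)
    finally show ?thesis .
  qed
  thus ?thesis using H by simp
qed

section \<open>Finiteness and existence of cliques\<close>

text \<open>Compatibility makes a subgraph share \<open>tail\<close> and \<open>head\<close> with
  \<open>G\<close>, so its vertex and arc sets determine it. The maximum over all cliques is then
  one over a finite set.\<close>

lemma (in fin_digraph) finite_cliques: "finite (cliques G m)"
proof (rule finite_subset)
  let ?f = "\<lambda>(V, E). \<lparr>verts = V, arcs = E, tail = tail G, head = head G\<rparr>"
  show "cliques G m \<subseteq> ?f ` (Pow (verts G) \<times> Pow (arcs G))"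
  proof
    fix H assume "H \<in> cliques G m"
    hence "H = ?f (verts H, arcs H)" "verts H \<subseteq> verts G" "arcs H \<subseteq> arcs G"
      by (auto simp: cliques_def subgraph_def compatible_def)
    thus "H \<in> ?f ` (Pow (verts G) \<times> Pow (arcs G))" by blast
  qed
qed auto

lemma (in fin_digraph) card_verts_clique:
  assumes "H \<in> cliques G m"
  shows "card (verts H) = m" and "verts H \<subseteq> verts G"
  using assms by (auto simp: cliques_def complete_digraph_def subgraph_def)

text \<open>Makes the set of orders in \<open>clique_number\<close> nonempty, so that its maximum is
  attained.\<close>

lemma (in wf_digraph) empty_clique: "cliques G 0 \<noteq> {}"
proof -
  let ?H = "\<lparr>verts = {}, arcs = {}, tail = tail G, head = head G\<rparr>"
  have "graph ?H" by unfold_locales (auto simp: symmetric_def arcs_ends_def)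
  hence "?H \<in> cliques G 0"
    using wf_digraph
    by (auto simp: cliques_def subgraph_def complete_digraph_def compatible_def arcs_ends_def
        wf_digraph_def)
  thus ?thesis by blast
qed

lemma (in fin_digraph) cliques_clique_number_nonempty: "cliques G (clique_number G) \<noteq> {}"
proof -
  have "m \<le> card (verts G)" if "cliques G m \<noteq> {}" for m
    using that card_verts_clique finite_verts card_mono by (metis all_not_in_conv)
  hence "finite {m. cliques G m \<noteq> {}}" by (auto simp: finite_nat_set_iff_bounded_le)
  hence "Max {m. cliques G m \<noteq> {}} \<in> {m. cliques G m \<noteq> {}}"
    by (rule Max_in) (use empty_clique in blast)
  thus ?thesis by (simp add: clique_number_def)
qed

subsection \<open>The generalized distance matrix\<close>

lemma gen_distance_mat_carrier: "gen_distance_mat \<alpha> G vs \<in> carrier_mat (length vs) (length vs)"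
  by (simp add: gen_distance_mat_def transmission_mat_def distance_mat_def)

lemma gen_distance_mat_index:
  assumes "i < length vs" and "j < length vs"
  shows "gen_distance_mat \<alpha> G vs $$ (i, j) =
    \<alpha> * (if i = j then transmission G (vs ! i) else 0) + (1 - \<alpha>) * gdist G (vs ! i) (vs ! j)"
  using assms by (simp add: gen_distance_mat_def transmission_mat_def distance_mat_def)

lemma (in sym_digraph) gen_distance_mat_symmetric:
  "transpose_mat (gen_distance_mat \<alpha> G vs) = gen_distance_mat \<alpha> G vs"
  using gen_distance_mat_carrier[of \<alpha> G vs]
  by (intro eq_matI) (auto simp: gen_distance_mat_index gdist_commute)

section \<open>Quadratic forms as sums over vertices\<close>

lemma sum_nth_distinct:
  assumes "distinct vs"
  shows "(\<Sum>i<length vs. g (vs ! i)) = (\<Sum>u\<in>set vs. g u)"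
  using sum.reindex_bij_betw[OF bij_betw_nth[OF assms refl refl]] by simp

lemma gen_distance_mat_form:
  fixes f :: "'a \<Rightarrow> real"
  assumes vs: "distinct vs" "set vs = verts G"
  defines "x \<equiv> vec (length vs) (\<lambda>i. f (vs ! i))"
  shows "x \<bullet> (gen_distance_mat \<alpha> G vs *\<^sub>v x) =
      \<alpha> * (\<Sum>u\<in>verts G. (f u)\<^sup>2 * transmission G u)
      + (1 - \<alpha>) * (\<Sum>u\<in>verts G. \<Sum>v\<in>verts G. f u * f v * gdist G u v)"
proof -
  let ?n = "length vs" and ?A = "gen_distance_mat \<alpha> G vs"
  have x: "x \<in> carrier_vec ?n" by (simp add: x_def)
  have "x \<bullet> (?A *\<^sub>v x) = (\<Sum>i<?n. \<Sum>j<?n. x $ i * (?A $$ (i, j) * x $ j))"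
    by (rule scalar_prod_mult_mat_vec_sum[OF gen_distance_mat_carrier x x])
  also have "\<dots> = (\<Sum>i<?n. \<alpha> * ((f (vs ! i))\<^sup>2 * transmission G (vs ! i))
      + (1 - \<alpha>) * (\<Sum>j<?n. f (vs ! i) * f (vs ! j) * gdist G (vs ! i) (vs ! j)))"
  proof (rule sum.cong[OF refl])
    fix i assume "i \<in> {..<?n}"
    hence i: "i < ?n" by simp
    have "(\<Sum>j<?n. x $ i * (?A $$ (i, j) * x $ j)) =
        (\<Sum>j<?n. (if i = j then \<alpha> * ((f (vs ! i))\<^sup>2 * transmission G (vs ! i)) else 0)
          + (1 - \<alpha>) * (f (vs ! i) * f (vs ! j) * gdist G (vs ! i) (vs ! j)))"
      using i by (intro sum.cong refl)
        (auto simp: gen_distance_mat_index x_def algebra_simps power2_eq_square)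
    also have "\<dots> = \<alpha> * ((f (vs ! i))\<^sup>2 * transmission G (vs ! i))
      + (1 - \<alpha>) * (\<Sum>j<?n. f (vs ! i) * f (vs ! j) * gdist G (vs ! i) (vs ! j))"
      using i by (simp add: sum.distrib sum_distrib_left)
    finally show "(\<Sum>j<?n. x $ i * (?A $$ (i, j) * x $ j)) = \<dots>" .
  qed
  also have "\<dots> = \<alpha> * (\<Sum>u\<in>verts G. (f u)\<^sup>2 * transmission G u)
      + (1 - \<alpha>) * (\<Sum>u\<in>verts G. \<Sum>v\<in>verts G. f u * f v * gdist G u v)"
    unfolding sum.distrib sum_distrib_left[symmetric]
    by (subst (1 2 3) sum_nth_distinct[OF vs(1), unfolded vs(2)]) simp
  finally show ?thesis .
qed

text \<open>The row sums of the distance matrix are the transmissions, so \<open>Tr\<close> and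
  \<open>D\<close> give the same coefficients of \<open>y\<^sup>2\<close> and \<open>y z\<close>,
  and \<alpha> cancels there. Only the coefficient of \<open>z\<^sup>2\<close> keeps it.\<close>

lemma gen_distance_mat_test_vector:
  fixes \<alpha> y z :: real
  assumes vs: "distinct vs" "set vs = verts G" and S: "S \<subseteq> verts G"
    and sym: "\<And>u v. gdist G u v = gdist G v u"
  defines "x \<equiv> vec (length vs) (\<lambda>i. y + z * of_bool (vs ! i \<in> S))"
    and "s \<equiv> \<Sum>u\<in>S. transmission G u"
  shows "x \<bullet> x = real (card (verts G)) * y\<^sup>2 + 2 * real (card S) * y * z + real (card S) * z\<^sup>2"
    and "x \<bullet> (gen_distance_mat \<alpha> G vs *\<^sub>v x) = 2 * wiener_index G * y\<^sup>2 + 2 * s * y * z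
      + (\<alpha> * s + (1 - \<alpha>) * (\<Sum>u\<in>S. \<Sum>v\<in>S. gdist G u v)) * z\<^sup>2"
proof -
  let ?V = "verts G" and ?f = "\<lambda>u. y + z * of_bool (u \<in> S)"
  have fin: "finite ?V" using vs(2) by (metis List.finite_set)
  have ind: "(\<Sum>u\<in>?V. of_bool (u \<in> S) * g u) = (\<Sum>u\<in>S. g u)" for g :: "'a \<Rightarrow> real"
    by (rule sum.mono_neutral_cong_right) (use fin S in auto)
  \<comment> \<open>The indicator of \<open>S\<close> is its own square.\<close>
  have sq: "(?f u)\<^sup>2 = y\<^sup>2 + of_bool (u \<in> S) * (2 * y * z + z\<^sup>2)" for u
    by (simp add: of_bool_def algebra_simps power2_eq_square)
  have "x \<bullet> x = (\<Sum>i<length vs. (?f (vs ! i))\<^sup>2)"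
    by (simp add: scalar_prod_def x_def power2_eq_square atLeast0LessThan)
  also have "\<dots> = (\<Sum>u\<in>?V. (?f u)\<^sup>2)"
    using sum_nth_distinct[OF vs(1), of "\<lambda>u. (?f u)\<^sup>2"] vs(2) by simp
  also have "\<dots> = real (card ?V) * y\<^sup>2 + 2 * real (card S) * y * z + real (card S) * z\<^sup>2"
    unfolding sq sum.distrib ind by (simp add: algebra_simps)
  finally show "x \<bullet> x = real (card ?V) * y\<^sup>2 + 2 * real (card S) * y * z + real (card S) * z\<^sup>2" .
  have W: "(\<Sum>u\<in>?V. transmission G u) = 2 * wiener_index G"
    by (simp add: wiener_index_def)
  have tr: "(\<Sum>u\<in>?V. (?f u)\<^sup>2 * transmission G u) = 2 * wiener_index G * y\<^sup>2 + (2 * y * z + z\<^sup>2) * s"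
  proof -
    have "(\<Sum>u\<in>?V. (?f u)\<^sup>2 * transmission G u) =
        y\<^sup>2 * (\<Sum>u\<in>?V. transmission G u)
        + (2 * y * z + z\<^sup>2) * (\<Sum>u\<in>?V. of_bool (u \<in> S) * transmission G u)"
      unfolding sq sum_distrib_left sum.distrib[symmetric]
      by (intro sum.cong refl) (simp add: algebra_simps)
    thus ?thesis unfolding W ind s_def by (simp add: algebra_simps)
  qed
  \<comment> \<open>\<open>transmission\<close> sums over the first argument of the distance;
    symmetry moves the sum to the second.\<close>
  have T: "(\<Sum>v\<in>?V. gdist G u v) = transmission G u" for u
    unfolding transmission_def by (rule sum.cong) (use sym in auto)
  have dS: "(\<Sum>u\<in>?V. \<Sum>v\<in>S. gdist G u v) = s"
    unfolding s_def transmission_def by (rule sum.swap)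
  have inner: "(\<Sum>v\<in>?V. ?f v * gdist G u v) = y * transmission G u + z * (\<Sum>v\<in>S. gdist G u v)" for u
    unfolding T[symmetric] ind[symmetric] sum_distrib_left sum.distrib[symmetric]
    by (intro sum.cong refl) (simp add: algebra_simps)
  have "(\<Sum>u\<in>?V. \<Sum>v\<in>?V. ?f u * ?f v * gdist G u v) =
      (\<Sum>u\<in>?V. ?f u * (y * transmission G u + z * (\<Sum>v\<in>S. gdist G u v)))"
    unfolding inner[symmetric] by (simp add: sum_distrib_left mult.assoc)
  also have "\<dots> = y\<^sup>2 * (\<Sum>u\<in>?V. transmission G u) + y * z * (\<Sum>u\<in>?V. \<Sum>v\<in>S. gdist G u v)
      + y * z * (\<Sum>u\<in>?V. of_bool (u \<in> S) * transmission G u)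
      + z\<^sup>2 * (\<Sum>u\<in>?V. of_bool (u \<in> S) * (\<Sum>v\<in>S. gdist G u v))"
    unfolding sum_distrib_left[of _ _ ?V] sum.distrib[symmetric]
    by (intro sum.cong refl) (simp add: algebra_simps power2_eq_square)
  also have "\<dots> = 2 * wiener_index G * y\<^sup>2 + 2 * s * y * z + (\<Sum>u\<in>S. \<Sum>v\<in>S. gdist G u v) * z\<^sup>2"
    unfolding W dS ind s_def[symmetric] by (simp add: algebra_simps)
  finally have d: "(\<Sum>u\<in>?V. \<Sum>v\<in>?V. ?f u * ?f v * gdist G u v) = \<dots>" .
  show "x \<bullet> (gen_distance_mat \<alpha> G vs *\<^sub>v x) = 2 * wiener_index G * y\<^sup>2 + 2 * s * y * z
      + (\<alpha> * s + (1 - \<alpha>) * (\<Sum>u\<in>S. \<Sum>v\<in>S. gdist G u v)) * z\<^sup>2"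
    unfolding x_def gen_distance_mat_form[OF vs, of ?f] tr d by (simp add: algebra_simps)
qed

text \<open>
  \<open>M\<close> and \<open>m\<close> lie outside the open interval between the roots of \<open>w (N - w) t\<^sup>2 - a t + b\<close>; the vectors
  \<open>(0, 1)\<close> and \<open>(1, -1)\<close> show that they lie on opposite sides of it.
\<close>

lemma spread_ge_compression:
  fixes M m N w p q r :: real
  assumes w: "0 < w" "w < N"
    and upper: "\<And>y z. r * y\<^sup>2 + 2 * q * y * z + p * z\<^sup>2 \<le> M * (N * y\<^sup>2 + 2 * w * y * z + w * z\<^sup>2)"
    and lower: "\<And>y z. m * (N * y\<^sup>2 + 2 * w * y * z + w * z\<^sup>2) \<le> r * y\<^sup>2 + 2 * q * y * z + p * z\<^sup>2"
  shows "sqrt ((p * N + w * r - 2 * w * q)\<^sup>2 - 4 * (r * p - q\<^sup>2) * (w * (N - w))) / (w * (N - w)) \<le> M - m"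
proof -
  define X a b where "X = w * (N - w)" and "a = p * N + w * r - 2 * w * q" and "b = r * p - q\<^sup>2"
  have X: "X > 0" using w by (simp add: X_def)
  have discr: "a\<^sup>2 - 4 * b * X \<le> (2 * X * t - a)\<^sup>2" if "(w * t - q)\<^sup>2 \<le> (N * t - r) * (w * t - p)" for t
  proof -
    have "0 \<le> X * t\<^sup>2 - a * t + b"
      using that by (simp add: X_def a_def b_def algebra_simps power2_eq_square)
    \<comment> \<open>The factor \<open>4 X\<close> completes the square: the right side is
      \<open>(2 X t - a)\<^sup>2 - (a\<^sup>2 - 4 b X)\<close>.\<close>
    hence "0 \<le> 4 * X * (X * t\<^sup>2 - a * t + b)" using X by simp
    thus ?thesis by (simp add: algebra_simps power2_eq_square)
  qed
  have "(w * M - q)\<^sup>2 \<le> (N * M - r) * (w * M - p)"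
  proof (rule binary_form_nonneg_imp_discriminant)
    show "0 \<le> (N * M - r) * y\<^sup>2 + 2 * (w * M - q) * y * z + (w * M - p) * z\<^sup>2" for y z
      using upper[of y z] by (simp add: algebra_simps)
  qed
  moreover have "0 \<le> 2 * X * M - a"
  proof -
    have "0 \<le> w * M - p" "0 \<le> (N - w) * M - (r - 2 * q + p)"
      using upper[of 0 1] upper[of 1 "- 1"] by (simp_all add: algebra_simps)
    \<comment> \<open>The weights give both coefficients of \<open>M\<close> the common value
      \<open>X\<close>, and the constant terms then add up to \<open>- a\<close>.\<close>
    hence "0 \<le> (N - w) * (w * M - p) + w * ((N - w) * M - (r - 2 * q + p))"
      using w by (intro add_nonneg_nonneg mult_nonneg_nonneg) auto
    thus ?thesis by (simp add: X_def a_def algebra_simps)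
  qed
  ultimately have 1: "sqrt (a\<^sup>2 - 4 * b * X) \<le> 2 * X * M - a"
    using discr by (intro real_le_lsqrt) auto
  have "(w * m - q)\<^sup>2 = (q - w * m)\<^sup>2" by (rule power2_commute)
  also have "\<dots> \<le> (r - N * m) * (p - w * m)"
  proof (rule binary_form_nonneg_imp_discriminant)
    show "0 \<le> (r - N * m) * y\<^sup>2 + 2 * (q - w * m) * y * z + (p - w * m) * z\<^sup>2" for y z
      using lower[of y z] by (simp add: algebra_simps)
  qed
  also have "\<dots> = (N * m - r) * (w * m - p)" by (simp add: algebra_simps)
  finally have "a\<^sup>2 - 4 * b * X \<le> (a - 2 * X * m)\<^sup>2"
    using discr[of m] by (simp add: power2_commute)
  moreover have "0 \<le> a - 2 * X * m"
  proof -
    have "0 \<le> p - w * m" "0 \<le> (r - 2 * q + p) - (N - w) * m"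
      using lower[of 0 1] lower[of 1 "- 1"] by (simp_all add: algebra_simps)
    hence "0 \<le> (N - w) * (p - w * m) + w * ((r - 2 * q + p) - (N - w) * m)"
      using w by (intro add_nonneg_nonneg mult_nonneg_nonneg) auto
    thus ?thesis by (simp add: X_def a_def algebra_simps)
  qed
  ultimately have 2: "sqrt (a\<^sup>2 - 4 * b * X) \<le> a - 2 * X * m"
    by (intro real_le_lsqrt) auto
  have "sqrt (a\<^sup>2 - 4 * b * X) \<le> (M - m) * X" using 1 2 by (simp add: algebra_simps)
  hence "sqrt (a\<^sup>2 - 4 * b * X) / X \<le> M - m" using X by (simp add: divide_le_eq)
  thus ?thesis by (simp add: X_def a_def b_def)
qed

section \<open>The spread of graphs with a clique and of complete graphs\<close>

text \<open>The compression bound with \<open>N = n\<close>, \<open>r = 2 W\<close>,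
  \<open>q = s\<close>. Then \<open>a\<close> and \<open>b\<close> are the coefficients of the
  quadratic whose roots are the eigenvalues of the form on the plane of test vectors.\<close>

lemma clique_spread_bound:
  fixes \<alpha> :: real
  assumes G: "graph G" and vs: "distinct vs" "set vs = verts G"
    and H: "H \<in> cliques G m" and m: "0 < m" "m < card (verts G)"
  defines "n \<equiv> real (card (verts G))" and "w \<equiv> real m" and "W \<equiv> wiener_index G"
    and "s \<equiv> \<Sum>v\<in>verts H. transmission G v"
  defines "a \<equiv> s * (\<alpha> * n - 2 * w) + w * (2 * W + (1 - \<alpha>) * n * (w - 1))"
    and "b \<equiv> 2 * W * w * (w - 1) - s\<^sup>2 + 2 * W * \<alpha> * (s - w * (w - 1))"
  shows "sqrt (a\<^sup>2 - 4 * b * (w * (n - w))) / (w * (n - w)) \<le> gen_distance_spread \<alpha> G vs"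
proof -
  interpret graph G by (rule G)
  let ?A = "gen_distance_mat \<alpha> G vs" and ?n = "length vs" and ?S = "verts H"
  have len: "?n = card (verts G)" using vs by (metis distinct_card)
  hence n0: "?n > 0" using m by simp
  have S: "?S \<subseteq> verts G" and card: "card ?S = m" using card_verts_clique[OF H] by auto
  \<comment> \<open>The value of the form at the indicator vector of the clique, whose internal
    distances sum to \<open>w (w - 1)\<close>.\<close>
  define p where "p = \<alpha> * s + (1 - \<alpha>) * (w * (w - 1))"
  let ?x = "\<lambda>y z. vec ?n (\<lambda>i. y + z * of_bool (vs ! i \<in> ?S)) :: real vec"
  have xc: "?x y z \<in> carrier_vec ?n" for y z by simp
  have norm: "?x y z \<bullet> ?x y z = n * y\<^sup>2 + 2 * w * y * z + w * z\<^sup>2" for y z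
    using gen_distance_mat_test_vector(1)[OF vs S gdist_commute] card by (simp add: n_def w_def)
  have form: "?x y z \<bullet> (?A *\<^sub>v ?x y z) = 2 * W * y\<^sup>2 + 2 * s * y * z + p * z\<^sup>2" for y z
    using gen_distance_mat_test_vector(2)[OF vs S gdist_commute]
    by (simp add: s_def p_def W_def w_def sum_gdist_clique[OF H])
  note Rayleigh = symmetric_mat_nth_eigenvalue_Rayleigh[OF gen_distance_mat_carrier[of \<alpha> G vs]
      gen_distance_mat_symmetric n0 xc, unfolded norm form]
  have "sqrt ((p * n + w * (2 * W) - 2 * w * s)\<^sup>2 - 4 * (2 * W * p - s\<^sup>2) * (w * (n - w))) / (w * (n - w))
      \<le> nth_eigenvalue ?A 1 - nth_eigenvalue ?A ?n"
    by (rule spread_ge_compression[OF _ _ Rayleigh]) (use m in \<open>auto simp: w_def n_def\<close>)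
  moreover have "p * n + w * (2 * W) - 2 * w * s = a"
    by (simp add: p_def a_def algebra_simps)
  moreover have "2 * W * p - s\<^sup>2 = b"
    by (simp add: p_def b_def algebra_simps)
  ultimately show ?thesis by (simp add: gen_distance_spread_def)
qed

text \<open>Let \<open>S\<close> be the coordinate sum of an eigenvector. If \<open>S = 0\<close>,
  the all-ones part \<open>J\<close> vanishes on it and the eigenvalue is
  \<open>\<alpha> n - 1\<close>; otherwise adding up all coordinates of the eigenvalue equation and
  cancelling \<open>S\<close> gives \<open>n - 1\<close>.\<close>

lemma complete_graph_spread:
  fixes \<alpha> :: real
  assumes G: "graph G" and \<alpha>: "\<alpha> \<le> 1" and vs: "distinct vs" "set vs = verts G"
    and H: "H \<in> cliques G (card (verts G))" and n: "card (verts G) \<ge> 2"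
  shows "gen_distance_spread \<alpha> G vs = (1 - \<alpha>) * real (card (verts G))"
proof -
  interpret graph G by (rule G)
  let ?A = "gen_distance_mat \<alpha> G vs"
  define n where "n = length vs"
  have len: "n = card (verts G)" using vs by (metis distinct_card n_def)
  have A: "?A \<in> carrier_mat n n" by (simp add: n_def gen_distance_mat_carrier)
  \<comment> \<open>A clique of full order contains every vertex, so all distances in
    \<open>G\<close> are 0 or 1.\<close>
  have VH: "verts H = verts G"
    using card_verts_clique[OF H] by (simp add: card_subset_eq)
  have d: "gdist G u v = (if u = v then 0 else 1)" if "u \<in> verts G" "v \<in> verts G" for u v
    using gdist_clique[OF H] that VH by simp
  have tr: "transmission G v = real n - 1" if v: "v \<in> verts G" for v
  proof -
    have "transmission G v = (\<Sum>u\<in>verts G. 1 - of_bool (u = v))"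
      unfolding transmission_def by (rule sum.cong) (use d v in auto)
    also have "\<dots> = real n - 1"
      using v len by (simp add: sum_subtractf of_bool_def)
    finally show ?thesis .
  qed
  have nthV: "vs ! i \<in> verts G" if "i < n" for i using that vs(2) nth_mem n_def by metis
  have Aij: "?A $$ (i, j) = (if i = j then \<alpha> * real n - 1 else 0) + (1 - \<alpha>)"
    if "i < n" "j < n" for i j
    using that vs(1) nthV
    by (auto simp: gen_distance_mat_index n_def[symmetric] tr d nth_eq_iff_index_eq algebra_simps)
  have Av: "(?A *\<^sub>v v) $ i = (\<alpha> * real n - 1) * v $ i + (1 - \<alpha>) * (\<Sum>j<n. v $ j)"
    if v: "v \<in> carrier_vec n" and i: "i < n" for v i
  proof -
    have "(?A *\<^sub>v v) $ i = (\<Sum>j<n. ?A $$ (i, j) * v $ j)"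
      using A v i by (simp add: scalar_prod_def atLeast0LessThan)
    also have "\<dots> = (\<Sum>j<n. (if i = j then (\<alpha> * real n - 1) * v $ i else 0) + (1 - \<alpha>) * v $ j)"
      using i by (intro sum.cong refl) (auto simp: Aij algebra_simps)
    also have "\<dots> = (\<alpha> * real n - 1) * v $ i + (1 - \<alpha>) * (\<Sum>j<n. v $ j)"
      using i by (simp add: sum.distrib sum_distrib_left)
    finally show ?thesis .
  qed
  have ev: "{e. eigenvalue ?A e} = {real n - 1, \<alpha> * real n - 1}"
  proof (intro equalityI subsetI)
    fix e assume "e \<in> {e. eigenvalue ?A e}"
    then obtain v where v: "v \<in> carrier_vec n" "v \<noteq> 0\<^sub>v n" "?A *\<^sub>v v = e \<cdot>\<^sub>v v"
      using A by (auto simp: eigenvalue_def eigenvector_def)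
    define S where "S = (\<Sum>j<n. v $ j)"
    have comp: "e * v $ i = (\<alpha> * real n - 1) * v $ i + (1 - \<alpha>) * S" if "i < n" for i
      using Av[OF v(1) that] v that by (simp add: S_def)
    show "e \<in> {real n - 1, \<alpha> * real n - 1}"
    proof (cases "S = 0")
      case True
      obtain i where "i < n" "v $ i \<noteq> 0"
        using v(1,2) by (metis carrier_vecD eq_vecI index_zero_vec(1,2))
      thus ?thesis using comp[of i] True by auto
    next
      case False
      have "e * S = (\<Sum>i<n. e * v $ i)" by (simp add: S_def sum_distrib_left)
      also have "\<dots> = (\<Sum>i<n. (\<alpha> * real n - 1) * v $ i + (1 - \<alpha>) * S)"
        by (intro sum.cong refl comp) simp
      also have "\<dots> = (\<alpha> * real n - 1) * S + real n * ((1 - \<alpha>) * S)"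
        unfolding sum.distrib sum_distrib_left[symmetric] S_def[symmetric] by simp
      also have "\<dots> = (real n - 1) * S" by (simp add: algebra_simps)
      finally show ?thesis using False by simp
    qed
  next
    fix e assume "e \<in> {real n - 1, \<alpha> * real n - 1}"
    then consider "e = real n - 1" | "e = \<alpha> * real n - 1" by auto
    thus "e \<in> {e. eigenvalue ?A e}"
    proof cases
      case 1
      let ?v = "vec n (\<lambda>_. 1 :: real)"
      have "?A *\<^sub>v ?v = e \<cdot>\<^sub>v ?v"
        using A 1 by (intro eq_vecI) (auto simp: Av algebra_simps simp del: index_mult_mat_vec)
      moreover have "?v \<noteq> 0\<^sub>v n"
        using n len by (auto simp: vec_eq_iff intro!: exI[of _ 0])
      ultimately show ?thesis
        using A by (auto simp: eigenvalue_def eigenvector_def intro!: exI[of _ ?v])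
    next
      case 2
      \<comment> \<open>A nonzero vector of coordinate sum 0; its two entries require
        \<open>n \<ge> 2\<close>.\<close>
      let ?v = "vec n (\<lambda>i. of_bool (i = 0) - of_bool (i = 1) :: real)"
      have "(\<Sum>j<n. ?v $ j) = (\<Sum>j<n. (if j = 0 then 1 else 0) - (if j = 1 then 1 else 0))"
        by (rule sum.cong) auto
      also have "\<dots> = 0" using n len by (simp add: sum_subtractf)
      finally have "?A *\<^sub>v ?v = e \<cdot>\<^sub>v ?v"
        using A 2 by (intro eq_vecI) (auto simp: Av simp del: index_mult_mat_vec)
      moreover have "?v \<noteq> 0\<^sub>v n"
        using n len by (auto simp: vec_eq_iff intro!: exI[of _ 0])
      ultimately show ?thesis
        using A by (auto simp: eigenvalue_def eigenvector_def intro!: exI[of _ ?v])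
    qed
  qed
  \<comment> \<open>Decides which of the two eigenvalues is the maximum; they coincide when \<alpha>
    is 1.\<close>
  have le: "\<alpha> * real n \<le> real n" using mult_right_mono[OF \<alpha>, of "real n"] by simp
  have n0: "n > 0" using n len by simp
  have "transpose_mat ?A = ?A" by (rule gen_distance_mat_symmetric)
  note extreme = symmetric_mat_extreme_nth_eigenvalue(1,2)[OF A this n0, unfolded ev]
  show ?thesis
    unfolding gen_distance_spread_def n_def[symmetric] extreme len[symmetric]
    using le by (simp add: algebra_simps)
qed

theorem theorem4p1:
  fixes G :: "('a, 'b) pre_digraph" and vs :: "'a list"
    and n \<omega> :: nat and \<alpha> W :: real
    and s a b :: "('a, 'b) pre_digraph \<Rightarrow> real"
  assumes "0 \<le> \<alpha>" and "\<alpha> \<le> 1"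
    and "Digraph.graph G" and "Digraph_Component.connected G"
    and "distinct vs" and "set vs = verts G"
    and "card (verts G) = n" and "n \<ge> 3"
    and "clique_number G = \<omega>" and "\<omega> \<ge> 2"
    and "wiener_index G = W"
  defines "s \<equiv> \<lambda>H. \<Sum>v\<in>verts H. transmission G v"
    and "a \<equiv> \<lambda>H. s H * (\<alpha> * real n - 2 * real \<omega>)
                + real \<omega> * (2 * W + (1 - \<alpha>) * real n * (real \<omega> - 1))"
    and "b \<equiv> \<lambda>H. 2 * W * real \<omega> * (real \<omega> - 1) - (s H)\<^sup>2
                + 2 * W * \<alpha> * (s H - real \<omega> * (real \<omega> - 1))"
  shows "(\<omega> \<le> n - 1 \<longrightarrow>
            gen_distance_spread \<alpha> G vs \<ge>
              Max ((\<lambda>H. sqrt ((a H)\<^sup>2 - 4 * b H * (real \<omega> * (real n - real \<omega>)))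
                         / (real \<omega> * (real n - real \<omega>))) ` cliques G \<omega>))
       \<and> (\<omega> = n \<longrightarrow> gen_distance_spread \<alpha> G vs = (1 - \<alpha>) * real n)"
proof (intro conjI impI)
  interpret graph G by (rule assms(3))
  \<comment> \<open>Used in both parts: it supplies the clique of order \<open>n\<close> in (ii),
    and makes the maximum in (i) range over a nonempty set.\<close>
  have ne: "cliques G \<omega> \<noteq> {}"
    using cliques_clique_number_nonempty assms(9) by simp
  show "gen_distance_spread \<alpha> G vs = (1 - \<alpha>) * real n" if "\<omega> = n"
    using complete_graph_spread[OF assms(3,2,5,6)] ne that assms(7,8) by auto
  assume "\<omega> \<le> n - 1"
  \<comment> \<open>The subtraction \<open>n - 1\<close> is on natural numbers;
    \<open>n \<ge> 3\<close> turns the assumption into a strict inequality, so the denominators are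
    positive.\<close>
  hence \<omega>: "0 < \<omega>" "\<omega> < card (verts G)" using assms(7,8,10) by auto
  show "Max ((\<lambda>H. sqrt ((a H)\<^sup>2 - 4 * b H * (real \<omega> * (real n - real \<omega>)))
                         / (real \<omega> * (real n - real \<omega>))) ` cliques G \<omega>)
      \<le> gen_distance_spread \<alpha> G vs"
  proof (rule Max.boundedI)
    fix t
    assume "t \<in> (\<lambda>H. sqrt ((a H)\<^sup>2 - 4 * b H * (real \<omega> * (real n - real \<omega>)))
                         / (real \<omega> * (real n - real \<omega>))) ` cliques G \<omega>"
    then obtain H where "H \<in> cliques G \<omega>"
      and t: "t = sqrt ((a H)\<^sup>2 - 4 * b H * (real \<omega> * (real n - real \<omega>)))
                         / (real \<omega> * (real n - real \<omega>))" by blast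
    thus "t \<le> gen_distance_spread \<alpha> G vs"
      using clique_spread_bound[OF assms(3,5,6) _ \<omega>, of H \<alpha>] assms(7,11)
      by (simp add: a_def b_def s_def)
  qed (use ne finite_cliques in auto)
qed

end
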